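(* Let $D$ be a real symmetric matrix of order $n$ with $\mathbf{e}\in R(D)$, and let $\mathbf{w}\in\mathbb{R}^n$ satisfy $\mathbf{e}'\mathbf{w}=1$. Let $L$ be a real Laplacian-like matrix of order $n$ and let $\alpha$ be a non-zero real number. Then $$D^{\dagger}=-\frac12L+\alpha\,\mathbf{w}\mathbf{w}'$$ if and only if $D\mathbf{w}=\frac1\alpha\mathbf{e}$ and $LD+2I=2\mathbf{w}\mathbf{e}'+\widetilde V$ for some real symmetric matrix $\widetilde V$ satisfying $D\widetilde V=O$ and $\widetilde V\left(-\frac12L+\alpha\,\mathbf{w}\mathbf{w}'\right)=O$.
   Context: A prime denotes transpose; $\mathbf{e}\in\mathbb{R}^n$ is the all-ones column vector; $R(D)$ is the range (column space) of $D$; $I$ is the identity and $O$ the zero matrix of order $n$. A real matrix is Laplacian-like if it is symmetric and all its row sums are zero. The Moore-Penrose inverse $M^\dagger$ of a real matrix $M$ is the unique $X$ with $MXM=M$, $XMX=X$, $(MX)'=MX$, $(XM)'=XM$. *)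

theory Defs
  imports "HOL-Analysis.Analysis"
begin

abbreviation all_ones :: "real ^ 'n"
  where "all_ones \<equiv> vec 1"

(* outer x y is the rank-one matrix x y' *)
definition outer :: "real ^ 'm \<Rightarrow> real ^ 'n \<Rightarrow> real ^ 'n ^ 'm"
  where "outer x y = (\<chi> i j. x $ i * y $ j)"

definition symmetric_matrix :: "real ^ 'n ^ 'n \<Rightarrow> bool"
  where "symmetric_matrix A \<longleftrightarrow> transpose A = A"

definition laplacian_like :: "real ^ 'n ^ 'n \<Rightarrow> bool"
  where "laplacian_like L \<longleftrightarrow> symmetric_matrix L \<and> (\<forall>i. (\<Sum>j\<in>UNIV. L $ i $ j) = 0)"

definition is_moore_penrose_inverse :: "real ^ 'n ^ 'm \<Rightarrow> real ^ 'm ^ 'n \<Rightarrow> bool"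
  where "is_moore_penrose_inverse M X \<longleftrightarrow>
    M ** X ** M = M \<and> X ** M ** X = X \<and>
    transpose (M ** X) = M ** X \<and> transpose (X ** M) = X ** M"

definition moore_penrose_inverse :: "real ^ 'n ^ 'm \<Rightarrow> real ^ 'm ^ 'n"
  where "moore_penrose_inverse M = (THE X. is_moore_penrose_inverse M X)"

lemma moore_penrose_unique:
  fixes M :: "real ^ 'n ^ 'm"
  assumes "is_moore_penrose_inverse M X" and "is_moore_penrose_inverse M Y"
  shows "X = Y"
proof -
  note X = assms(1)[unfolded is_moore_penrose_inverse_def]
  note Y = assms(2)[unfolded is_moore_penrose_inverse_def]
  have "M ** X = (M ** Y) ** (M ** X)"
    using Y by (simp add: matrix_mul_assoc)
  also have "\<dots> = transpose (M ** Y) ** transpose (M ** X)"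
    using X Y by simp
  also have "\<dots> = transpose (M ** X ** M ** Y)"
    by (simp add: matrix_transpose_mul matrix_mul_assoc)
  also have "\<dots> = M ** Y"
    using X Y by simp
  finally have MX: "M ** X = M ** Y" .
  have "X ** M = (X ** M) ** (Y ** M)"
    using Y by (metis matrix_mul_assoc)
  also have "\<dots> = transpose (X ** M) ** transpose (Y ** M)"
    using X Y by simp
  also have "\<dots> = transpose ((Y ** M) ** (X ** M))"
    by (simp add: matrix_transpose_mul)
  also have "\<dots> = Y ** M"
    using X Y by (metis matrix_mul_assoc)
  finally have XM: "X ** M = Y ** M" .
  show ?thesis
    using X Y MX XM by (metis matrix_mul_assoc)
qed

lemma generalized_inverse_exists:
  fixes M :: "real ^ 'n ^ 'm"
  shows "\<exists>G. M ** G ** M = M"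
proof -
  obtain g where g: "linear g" "\<forall>v\<in>range ((*v) M). M *v g v = v"
    using linear_exists_right_inverse_on[OF matrix_vector_mul_linear[of M] subspace_UNIV]
    by auto
  have "(M ** matrix g ** M) *v x = M *v x" for x
    using g by (simp add: matrix_vector_mul_assoc[symmetric] matrix_works)
  then show ?thesis
    by (metis matrix_eq)
qed

lemma transpose_mult_cancel:
  fixes A :: "real ^ 'n ^ 'm"
  assumes "transpose A ** A ** X = transpose A ** A ** Y"
  shows "A ** X = A ** Y"
proof -
  have "A *v (X *v v) = A *v (Y *v v)" for v
  proof -
    let ?u = "X *v v - Y *v v"
    have "transpose A *v (A *v ?u) = 0"
      using arg_cong[OF assms, of "\<lambda>B. B *v v"]
      by (simp add: matrix_vector_mult_diff_distrib matrix_vector_mul_assoc[symmetric])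
    then have "(A *v ?u) \<bullet> (A *v ?u) = 0"
      by (metis dot_lmul_matrix inner_zero_left vector_transpose_matrix
          transpose_matrix_vector transpose_transpose)
    then show ?thesis
      by (simp add: matrix_vector_mult_diff_distrib)
  qed
  then show ?thesis
    by (simp add: matrix_eq matrix_vector_mul_assoc[symmetric])
qed

lemma moore_penrose_exists:
  fixes M :: "real ^ 'n ^ 'm"
  shows "\<exists>X. is_moore_penrose_inverse M X"
proof -
  let ?T = "transpose M"
  obtain H where H: "(?T ** M) ** H ** (?T ** M) = ?T ** M"
    using generalized_inverse_exists by blast
  obtain G where G: "(M ** ?T) ** G ** (M ** ?T) = M ** ?T"
    using generalized_inverse_exists by blast
  have MHTM: "M ** (H ** ?T ** M) = M ** mat 1"
    by (rule transpose_mult_cancel) (use H in \<open>simp add: matrix_mul_assoc\<close>)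
  have "?T ** (G ** M ** ?T) = ?T ** mat 1"
    by (rule transpose_mult_cancel) (use G in \<open>simp add: matrix_mul_assoc\<close>)
  then have TGMT: "?T ** G ** M ** ?T = ?T"
    by (simp add: matrix_mul_assoc)
  have MHTM': "M ** H ** ?T ** M = M"
    using MHTM by (simp add: matrix_mul_assoc)
  define P where "P = M ** H ** ?T"
  define Q where "Q = ?T ** G ** M"
  have PM: "P ** M = M" using MHTM' by (simp add: P_def)
  have QT: "Q ** ?T = ?T" using TGMT by (simp add: Q_def)
  have TP: "?T ** transpose P = ?T"
    using arg_cong[OF PM, of transpose] by (simp add: matrix_transpose_mul)
  have MQ: "M ** transpose Q = M"
    using arg_cong[OF QT, of transpose] by (simp add: matrix_transpose_mul)
  have "P ** transpose P = P"
    using TP by (metis P_def matrix_mul_assoc)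
  then have Psym: "transpose P = P"
    by (metis matrix_transpose_mul transpose_transpose)
  have "Q ** transpose Q = Q"
    using MQ by (metis Q_def matrix_mul_assoc)
  then have Qsym: "transpose Q = Q"
    by (metis matrix_transpose_mul transpose_transpose)
  define X where "X = ?T ** G ** P"
  have MX: "M ** X = P"
    using MQ Qsym by (metis P_def Q_def X_def matrix_mul_assoc)
  have XM: "X ** M = Q"
    using PM by (metis Q_def X_def matrix_mul_assoc)
  have PP: "P ** P = P"
    using \<open>P ** transpose P = P\<close> Psym by simp
  have "X ** P = X"
    using PP by (metis X_def matrix_mul_assoc)
  then have "X ** M ** X = X"
    using MX by (metis matrix_mul_assoc)
  then have "is_moore_penrose_inverse M X"
    using MX XM PM Psym Qsym by (simp add: is_moore_penrose_inverse_def)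
  then show ?thesis ..
qed

lemma moore_penrose_inverse_eq_iff:
  "moore_penrose_inverse M = X \<longleftrightarrow> is_moore_penrose_inverse M X"
  unfolding moore_penrose_inverse_def
  by (metis moore_penrose_exists moore_penrose_unique the_equality)

end

(* Put X = -1/2 L + \<alpha> w w'.  If D w = e / \<alpha> then X D = w e' - 1/2 L D, so the matrix equation for V says
   precisely V = 2 (I - X D), and the conditions on V become the Penrose equations for X.
   In the forward direction, X e = \<alpha> w and D X e = e (as e lies in R(D)) give D w = e / \<alpha>. *)

theory Submission
  imports Defs
begin

lemma outer_mult_vec: "outer x y *v z = (y \<bullet> z) *\<^sub>R x"
  by (simp add: vec_eq_iff outer_def matrix_vector_mult_def inner_vec_def sum_distrib_left ac_simps)

lemma outer_matrix_mult: "outer x y ** A = outer x (transpose A *v y)"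
  by (simp add: vec_eq_iff outer_def matrix_matrix_mult_def matrix_vector_mult_def transpose_def
      sum_distrib_left ac_simps)

lemma outer_scaleR_right: "outer x (c *\<^sub>R y) = c *\<^sub>R outer x y"
  by (simp add: vec_eq_iff outer_def)

lemma transpose_outer: "transpose (outer x y) = outer y x"
  by (simp add: vec_eq_iff outer_def transpose_def)

lemma transpose_add: "transpose (A + B) = transpose A + transpose B"
  by (simp add: vec_eq_iff transpose_def)

lemma transpose_diff: "transpose (A - B) = transpose A - transpose B"
  for A B :: "'a::ab_group_add ^ 'n ^ 'm"
  by (simp add: vec_eq_iff transpose_def)

lemma laplacian_like_mult_ones: "laplacian_like L \<Longrightarrow> L *v all_ones = 0"
  by (simp add: vec_eq_iff laplacian_like_def matrix_vector_mult_def)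

lemma matrix_add_rdistrib: "(A + B) ** C = A ** C + B ** C"
  by (simp add: vec_eq_iff matrix_matrix_mult_def distrib_right sum.distrib)

lemma matrix_diff_ldistrib: "A ** (B - C) = A ** B - A ** C"
  for A :: "'a::ring_1 ^ 'n ^ 'm"
  by (simp add: vec_eq_iff matrix_matrix_mult_def right_diff_distrib sum_subtractf)

lemma matrix_diff_rdistrib: "(A - B) ** C = A ** C - B ** C"
  for A B :: "'a::ring_1 ^ 'n ^ 'm"
  by (simp add: vec_eq_iff matrix_matrix_mult_def left_diff_distrib sum_subtractf)

text \<open>For symmetric \<open>D\<close> and \<open>X\<close>, the products \<open>D ** X\<close>
  and \<open>X ** D\<close> are transposes of each other. Hence the two symmetry conditions in the
  Penrose equations both say that \<open>D\<close> and \<open>X\<close> commute, and one of them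
  suffices.\<close>

lemma symmetric_penrose_iff:
  fixes D X :: "real ^ 'n ^ 'n"
  assumes "symmetric_matrix D" and "symmetric_matrix X"
  shows "is_moore_penrose_inverse D X \<longleftrightarrow>
    symmetric_matrix (X ** D) \<and> D ** X ** D = D \<and> X ** D ** X = X"
  using assms unfolding is_moore_penrose_inverse_def symmetric_matrix_def
  by (metis matrix_transpose_mul)

theorem theorem4p1:
  fixes D L :: "real ^ 'n ^ 'n" and w :: "real ^ 'n" and \<alpha> :: real
  assumes "symmetric_matrix D"
    and "all_ones \<in> range ((*v) D)"
    and "all_ones \<bullet> w = 1"
    and "laplacian_like L"
    and "\<alpha> \<noteq> 0"
  shows "moore_penrose_inverse D = - (1 / 2) *\<^sub>R L + \<alpha> *\<^sub>R outer w w \<longleftrightarrow>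
    D *v w = (1 / \<alpha>) *\<^sub>R all_ones \<and>
    (\<exists>V :: real ^ 'n ^ 'n. symmetric_matrix V \<and>
       L ** D + 2 *\<^sub>R mat 1 = 2 *\<^sub>R outer w all_ones + V \<and>
       D ** V = 0 \<and>
       V ** (- (1 / 2) *\<^sub>R L + \<alpha> *\<^sub>R outer w w) = 0)"
proof -
  define X where "X = - (1 / 2) *\<^sub>R L + \<alpha> *\<^sub>R outer w w"
  define V where "V = 2 *\<^sub>R (mat 1 - X ** D)"
  have "symmetric_matrix X"
    using assms(4) unfolding X_def laplacian_like_def symmetric_matrix_def
    by (simp only: transpose_add transpose_scalar transpose_outer)
  then have penrose: "is_moore_penrose_inverse D X \<longleftrightarrow>
      symmetric_matrix (X ** D) \<and> D ** X ** D = D \<and> X ** D ** X = X"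
    by (rule symmetric_penrose_iff[OF assms(1)])
  have sym: "symmetric_matrix V \<longleftrightarrow> symmetric_matrix (X ** D)"
    by (simp add: V_def symmetric_matrix_def transpose_scalar transpose_diff)
  \<comment> \<open>Distributing gives D V = 2 (D - D X D), and likewise V X = 2 (X - X D X) in the
    next fact.\<close>
  have DV: "D ** V = 0 \<longleftrightarrow> D ** X ** D = D"
    by (auto simp: V_def matrix_scalar_ac scalar_matrix_assoc[symmetric] matrix_diff_ldistrib
        matrix_mul_assoc)
  have VX: "V ** X = 0 \<longleftrightarrow> X ** D ** X = X"
    by (auto simp: V_def scalar_matrix_assoc[symmetric] matrix_diff_rdistrib)
  \<comment> \<open>The equation leaves only one candidate for the existential witness, namely
    \<open>V\<close>.\<close>
  have eq: "L ** D + 2 *\<^sub>R mat 1 = 2 *\<^sub>R outer w all_ones + U \<longleftrightarrow> U = V"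
    if "D *v w = (1 / \<alpha>) *\<^sub>R all_ones" for U
  proof -
    \<comment> \<open>Symmetry of \<open>D\<close> gives w w' D = w (D w)', which is (1/\<alpha>) w
      e' by the assumption on D w; the factor \<alpha> then cancels.\<close>
    have "X ** D = - (1 / 2) *\<^sub>R (L ** D) + outer w all_ones"
      using that assms(1,5) unfolding X_def symmetric_matrix_def
      by (simp only: matrix_add_rdistrib scalar_matrix_assoc[symmetric] outer_matrix_mult
          outer_scaleR_right)
         simp
    then have "V = L ** D + 2 *\<^sub>R mat 1 - 2 *\<^sub>R outer w all_ones"
      by (simp add: V_def scaleR_diff_right scaleR_add_right)
    then show ?thesis
      by (auto simp: algebra_simps)
  qed
  \<comment> \<open>A single Penrose equation is enough here, so the forward direction obtains D w
    before using \<open>eq\<close>, which presupposes it.\<close>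
  have "D *v w = (1 / \<alpha>) *\<^sub>R all_ones" if "D ** X ** D = D"
  proof -
    obtain y where y: "all_ones = D *v y"
      using assms(2) by auto
    \<comment> \<open>The Laplacian part vanishes since L e = 0, and w w' e = w since e' w =
      1.\<close>
    have "X *v all_ones = \<alpha> *\<^sub>R w"
      unfolding X_def
      by (simp only: matrix_vector_mult_add_rdistrib scaleR_matrix_vector_assoc[symmetric]
          outer_mult_vec laplacian_like_mult_ones[OF assms(4)] inner_commute[of w] assms(3))
         simp
    then have "\<alpha> *\<^sub>R (D *v w) = D *v (X *v (D *v y))"
      by (simp only: y matrix_vector_mult_scaleR)
    \<comment> \<open>D X D y = D y = e.\<close>
    also have "\<dots> = all_ones"
      by (simp only: y matrix_vector_mul_assoc matrix_mul_assoc that)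
    finally have "(1 / \<alpha>) *\<^sub>R (\<alpha> *\<^sub>R (D *v w)) = (1 / \<alpha>) *\<^sub>R all_ones"
      by (rule arg_cong)
    then show ?thesis
      using assms(5) by simp
  qed
  \<comment> \<open>Either side yields D w = e / \<alpha>. Then \<open>eq\<close> reduces the
    existential to \<open>V\<close>, whose three conditions match those in \<open>penrose\<close>
    one by one through \<open>sym\<close>, \<open>DV\<close> and \<open>VX\<close>.\<close>
  then show ?thesis
    unfolding moore_penrose_inverse_eq_iff X_def[symmetric] penrose
    using eq sym DV VX by metis
qed

end
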